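(* Let $m,n,p$ be positive integers with $p\ge2$, let $\mathcal{S}\in S(m,n,p)$ be an s-diagonal tensor, and put $q=\min\{m,n\}$. Then $\mathcal{S}$ has the following four properties: (1) (tubal 2-norm decay) $\sum_{k=1}^p\mathcal{S}(1,1,k)^2\ge\sum_{k=1}^p\mathcal{S}(2,2,k)^2\ge\cdots\ge\sum_{k=1}^p\mathcal{S}(q,q,k)^2$; (2) (first frontal slice decay) $\mathcal{S}(1,1,1)\ge\mathcal{S}(2,2,1)\ge\cdots\ge\mathcal{S}(q,q,1)\ge0$; (3) (third mode symmetry) $\mathcal{S}(i,i,k)=\mathcal{S}(i,i,p-k+2)$ for $i=1,\dots,q$ and $k=2,3,\dots,1+\lfloor\frac{p-1}{2}\rfloor$; (4) (tubal leading entry maximum) $\mathcal{S}(i,i,1)\ge|\mathcal{S}(i,i,k)|$ for $i=1,\dots,q$ and $k=1,\dots,p$.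
   Context: Let $T(m,n,p)$ be the real linear space of $m\times n\times p$ real tensors; $\mathcal{A}(i,j,k)$ denotes the entries of $\mathcal{A}\in T(m,n,p)$ and $A^{(k)}=\mathcal{A}(:,:,k)\in\mathbb{R}^{m\times n}$ its frontal slices, $k=1,\dots,p$. A tensor is f-diagonal if all its frontal slices are (rectangular) diagonal matrices; $F(m,n,p)$ is the set of f-diagonal tensors in $T(m,n,p)$. Kilmer-Martin mapping $G:T(m,n,p)\to F(m,n,p)$. Let $\omega=e^{2\pi\sqrt{-1}/p}$. For $\mathcal{A}\in T(m,n,p)$ and $k=1,\dots,p$ put $\Delta^{(k)}(\mathcal{A})=\sum_{l=1}^p\omega^{(l-1)(k-1)}A^{(l)}\in\mathbb{C}^{m\times n}$, and let $\mathcal{D}(i,i,k)$, $i=1,\dots,\min\{m,n\}$, be the singular values of $\Delta^{(k)}(\mathcal{A})$ in nonincreasing order (counted with multiplicity). Then $\mathcal{S}=G(\mathcal{A})$ is the f-diagonal tensor with $\mathcal{S}(i,i,k)=\frac1p\sum_{l=1}^p\bar\omega^{(k-1)(l-1)}\mathcal{D}(i,i,l)$ for $i=1,\dots,\min\{m,n\}$, $k=1,\dots,p$ (these numbers are real). A tensor $\mathcal{S}\in F(m,n,p)$ is called s-diagonal if there is some $\mathcal{A}\in T(m,n,p)$ with $G(\mathcal{A})=\mathcal{S}$; $S(m,n,p)$ denotes the set of all s-diagonal tensors in $F(m,n,p)$. *)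

theory Defs
  imports
    "HOL-Library.Multiset"
    "HOL-Computational_Algebra.Fundamental_Theorem_Algebra"
    "Jordan_Normal_Form.Char_Poly"
    "Jordan_Normal_Form.Schur_Decomposition"
begin

text \<open>
  Third-order tensors are functions of three indices starting at 1.  An \<open>m \<times> n \<times> p\<close> tensor is
  required to vanish outside its index box, so that equality of tensors is equality of functions.
  Matrices (type \<open>mat\<close>) and lists are indexed from 0; hence the shifts below.
\<close>

type_synonym tensor = "nat \<Rightarrow> nat \<Rightarrow> nat \<Rightarrow> real"

definition tensors :: "nat \<Rightarrow> nat \<Rightarrow> nat \<Rightarrow> tensor set" where
  "tensors m n p = {A. \<forall>i j k. A i j k \<noteq> 0 \<longrightarrow> i \<in> {1..m} \<and> j \<in> {1..n} \<and> k \<in> {1..p}}"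

definition frontal_slice :: "nat \<Rightarrow> nat \<Rightarrow> tensor \<Rightarrow> nat \<Rightarrow> real mat" where
  "frontal_slice m n A k = mat m n (\<lambda>(i, j). A (Suc i) (Suc j) k)"

definition f_diagonal_tensors :: "nat \<Rightarrow> nat \<Rightarrow> nat \<Rightarrow> tensor set" where
  "f_diagonal_tensors m n p =
     {A \<in> tensors m n p. \<forall>k\<in>{1..p}. \<forall>i<m. \<forall>j<n.
        i \<noteq> j \<longrightarrow> frontal_slice m n A k $$ (i, j) = 0}"

text \<open>
  The singular values are the square roots of the \<open>min (dim_row M) (dim_col M)\<close> largest
  eigenvalues of \<open>mat_adjoint M * M\<close>, counted with algebraic multiplicity (the remaining
  eigenvalues vanish), listed in nonincreasing order.  These eigenvalues are real and nonnegative,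
  so \<open>Re\<close> is only a type conversion.
\<close>

definition singular_values :: "complex mat \<Rightarrow> real list" where
  "singular_values M =
     take (min (dim_row M) (dim_col M))
       (rev (sorted_list_of_multiset
         (image_mset (\<lambda>e. sqrt (Re e)) (proots (char_poly (mat_adjoint M * M))))))"

definition root_of_unity :: "nat \<Rightarrow> complex" where
  "root_of_unity p = exp (2 * of_real pi * \<i> / of_nat p)"

definition Delta :: "nat \<Rightarrow> nat \<Rightarrow> nat \<Rightarrow> tensor \<Rightarrow> nat \<Rightarrow> complex mat" where
  "Delta m n p A k =
     mat m n (\<lambda>(i, j). \<Sum>l = 1..p. root_of_unity p ^ ((l - 1) * (k - 1))
                                  * of_real (frontal_slice m n A l $$ (i, j)))"

text \<open>\<open>Dval m n p A i k\<close> is the \<open>i\<close>-th largest singular value of \<open>Delta m n p A k\<close>.\<close>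

definition Dval :: "nat \<Rightarrow> nat \<Rightarrow> nat \<Rightarrow> tensor \<Rightarrow> nat \<Rightarrow> nat \<Rightarrow> real" where
  "Dval m n p A i k = singular_values (Delta m n p A k) ! (i - 1)"

text \<open>
  The Kilmer-Martin mapping.  The complex number below is real since \<open>Delta m n p A l\<close> and
  \<open>Delta m n p A (p + 2 - l)\<close> are entrywise conjugate for \<open>2 \<le> l \<le> p\<close> and hence have the same
  singular values; \<open>Re\<close> is again only a type conversion.
\<close>

definition kilmer_martin :: "nat \<Rightarrow> nat \<Rightarrow> nat \<Rightarrow> tensor \<Rightarrow> tensor" where
  "kilmer_martin m n p A = (\<lambda>i j k.
     if i = j \<and> i \<in> {1..min m n} \<and> k \<in> {1..p}
     then Re (1 / of_nat p * (\<Sum>l = 1..p. cnj (root_of_unity p) ^ ((k - 1) * (l - 1))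
                                         * of_real (Dval m n p A i l)))
     else 0)"

definition s_diagonal_tensors :: "nat \<Rightarrow> nat \<Rightarrow> nat \<Rightarrow> tensor set" where
  "s_diagonal_tensors m n p =
     {S \<in> f_diagonal_tensors m n p. \<exists>A \<in> tensors m n p. kilmer_martin m n p A = S}"

end

theory Submission
  imports Defs
begin

text \<open>
  Each tube \<open>k \<mapsto> S i i k\<close> is the inverse discrete Fourier transform of the nonnegative sequence
  \<open>l \<mapsto> D i l\<close> of \<open>i\<close>-th singular values.  The first entry is the mean of that sequence, the triangle
  inequality makes it dominate the other entries, and reality of the sequence gives the reflection
  symmetry.  As \<open>A\<close> is real, \<open>\<Delta> l\<close> and \<open>\<Delta> (p + 2 - l)\<close> are entrywise conjugate and have the same
  singular values; so the transform is real and Parseval's identity carries the monotonicity of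
  \<open>D i l\<close> in \<open>i\<close> over to the tubal norms.
\<close>

section \<open>Singular values\<close>

lemma mat_adjoint_carrier:
  "M \<in> carrier_mat m n \<Longrightarrow> mat_adjoint M \<in> carrier_mat n m"
  by (auto simp: mat_adjoint_def)

lemma index_mat_adjoint:
  assumes "i < dim_col M" "j < dim_row M"
  shows "mat_adjoint M $$ (i, j) = conjugate (M $$ (j, i))"
  using assms by (simp add: mat_adjoint_def mat_of_rows_def)

lemma mat_adjoint_cscalar_prod:
  fixes M :: "complex mat"
  assumes M: "M \<in> carrier_mat m n" and v: "v \<in> carrier_vec n" and w: "w \<in> carrier_vec m"
  shows "(mat_adjoint M *\<^sub>v w) \<bullet>c v = w \<bullet>c (M *\<^sub>v v)"
proof -
  have "(mat_adjoint M *\<^sub>v w) \<bullet>c v =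
      (\<Sum>j<n. (\<Sum>i<m. cnj (M $$ (i, j)) * w $ i) * cnj (v $ j))"
    using M v w mat_adjoint_carrier[OF M]
    by (auto simp: scalar_prod_def index_mat_adjoint atLeast0LessThan intro!: sum.cong)
  also have "\<dots> = (\<Sum>j<n. \<Sum>i<m. w $ i * cnj (M $$ (i, j) * v $ j))"
    by (simp add: sum_distrib_left sum_distrib_right mult_ac)
  also have "\<dots> = (\<Sum>i<m. \<Sum>j<n. w $ i * cnj (M $$ (i, j) * v $ j))"
    by (rule sum.swap)
  also have "\<dots> = (\<Sum>i<m. w $ i * cnj (\<Sum>j<n. M $$ (i, j) * v $ j))"
    by (simp add: sum_distrib_left)
  also have "\<dots> = w \<bullet>c (M *\<^sub>v v)"
    using M v w by (auto simp: scalar_prod_def atLeast0LessThan intro!: sum.cong)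
  finally show ?thesis .
qed

text \<open>For an eigenvector \<open>v\<close>, pairing with \<open>v\<close> gives
  \<open>e * (v \<bullet>c v)\<close> as the squared norm of \<open>M *\<^sub>v v\<close>.\<close>

lemma eigenvalue_adjoint_mult_nonneg:
  fixes M :: "complex mat"
  assumes M: "M \<in> carrier_mat m n" and e: "eigenvalue (mat_adjoint M * M) e"
  shows "e \<ge> 0"
proof -
  obtain v where v: "v \<in> carrier_vec n" "v \<noteq> 0\<^sub>v n"
    and ev: "(mat_adjoint M * M) *\<^sub>v v = e \<cdot>\<^sub>v v"
    using e M mat_adjoint_carrier[OF M] unfolding eigenvalue_def eigenvector_def by auto
  have Mv: "M *\<^sub>v v \<in> carrier_vec m"
    using M v by auto
  have "e * (v \<bullet>c v) = (e \<cdot>\<^sub>v v) \<bullet>c v"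
    using v by simp
  also have "\<dots> = (mat_adjoint M *\<^sub>v (M *\<^sub>v v)) \<bullet>c v"
    by (simp add: ev[symmetric] assoc_mult_mat_vec[OF mat_adjoint_carrier[OF M] M v(1)])
  also have "\<dots> = (M *\<^sub>v v) \<bullet>c (M *\<^sub>v v)"
    by (rule mat_adjoint_cscalar_prod[OF M v(1) Mv])
  also have "\<dots> \<ge> 0" by auto
  finally have "0 \<le> e * (v \<bullet>c v)" .
  moreover have "v \<bullet>c v > 0"
    using v by simp
  \<comment> \<open>The order on \<open>complex\<close> also requires equal imaginary parts, so this
    yields that \<open>e\<close> is real as well as nonnegative.\<close>
  ultimately show ?thesis
    by (auto simp: less_eq_complex_def less_complex_def zero_le_mult_iff)
qed

lemma sqrt_eigenvalues_adjoint_mult: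
  fixes M :: "complex mat"
  assumes M: "M \<in> carrier_mat m n"
  defines "X \<equiv> image_mset (\<lambda>e. sqrt (Re e)) (proots (char_poly (mat_adjoint M * M)))"
  shows "size X = n" and "\<And>x. x \<in># X \<Longrightarrow> 0 \<le> x"
proof -
  have B: "mat_adjoint M * M \<in> carrier_mat n n"
    using M mat_adjoint_carrier[OF M] by auto
  have deg: "degree (char_poly (mat_adjoint M * M)) = n"
    using degree_monic_char_poly[OF B] by simp
  show "size X = n"
    by (simp add: X_def size_proots_complex deg)
  have "char_poly (mat_adjoint M * M) \<noteq> 0"
    using degree_monic_char_poly[OF B] by auto
  then show "0 \<le> x" if "x \<in># X" for x
    using that eigenvalue_adjoint_mult_nonneg[OF M] eigenvalue_root_char_poly[OF B]
    by (auto simp: X_def less_eq_complex_def)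
qed

section \<open>Length, sign, order and conjugation invariance of the singular values\<close>

text \<open>The characteristic polynomial has \<open>n\<close> complex roots and
  \<open>min m n \<le> n\<close>, so \<open>take\<close> never runs short. This keeps
  \<open>!\<close> in \<open>Dval\<close> within the list.\<close>

lemma length_singular_values:
  assumes M: "M \<in> carrier_mat m n"
  shows "length (singular_values M) = min m n"
proof -
  have "length (sorted_list_of_multiset X) = size X" for X :: "real multiset"
    by (metis mset_sorted_list_of_multiset size_mset)
  then show ?thesis
    using M sqrt_eigenvalues_adjoint_mult(1)[OF M] by (simp add: singular_values_def)
qed

lemma singular_values_nonneg:
  assumes "M \<in> carrier_mat m n" "x \<in> set (singular_values M)"
  shows "0 \<le> x"
  using assms(2) sqrt_eigenvalues_adjoint_mult(2)[OF assms(1)]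
  by (auto simp: singular_values_def dest!: in_set_takeD)

lemma sorted_singular_values:
  "sorted_wrt (\<ge>) (singular_values M)"
  unfolding singular_values_def
  by (intro sorted_wrt_take) (simp add: sorted_wrt_rev sorted_sorted_list_of_multiset)

text \<open>Conjugating \<open>M\<close> conjugates the Hermitian matrix
  \<open>mat_adjoint M * M\<close>, that is, transposes it, and transposition preserves the
  characteristic polynomial.\<close>

lemma singular_values_conjugate:
  fixes M :: "complex mat"
  shows "singular_values (map_mat cnj M) = singular_values M"
proof -
  define m n where "m = dim_row M" and "n = dim_col M"
  have M: "M \<in> carrier_mat m n" and B: "mat_adjoint M * M \<in> carrier_mat n n"
    using mat_adjoint_carrier[of M m n] by (auto simp: m_def n_def)
  have "mat_adjoint (map_mat cnj M) * map_mat cnj M = transpose_mat (mat_adjoint M * M)"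
    using M mat_adjoint_carrier[OF M] mat_adjoint_carrier[of "map_mat cnj M" m n]
    by (intro eq_matI) (auto simp: scalar_prod_def index_mat_adjoint mult.commute)
  then show ?thesis
    by (simp add: singular_values_def char_poly_transpose_mat[OF B])
qed

section \<open>The inverse discrete Fourier transform\<close>

lemma root_of_unity_power: "root_of_unity p ^ k = cis (2 * pi * real k / real p)"
  by (simp add: root_of_unity_def cis_conv_exp flip: exp_of_nat_mult) (simp add: mult_ac)

lemma root_of_unity_power_self: "p > 0 \<Longrightarrow> root_of_unity p ^ p = 1"
  by (simp add: root_of_unity_power)

lemma norm_root_of_unity: "norm (root_of_unity p) = 1"
  using root_of_unity_power[of p 1] by simp

lemma root_of_unity_mult_cnj: "root_of_unity p * cnj (root_of_unity p) = 1"
  by (simp add: complex_norm_square[symmetric] norm_root_of_unity)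

lemma root_of_unity_power_diff:
  assumes "p > 0" "l \<le> p"
  shows "root_of_unity p ^ ((p - l) * k) = cnj (root_of_unity p) ^ (l * k)"
proof -
  have "root_of_unity p ^ ((p - l) * k) * root_of_unity p ^ (l * k) = (root_of_unity p ^ p) ^ k"
    using assms(2) by (simp flip: power_add power_mult add_mult_distrib)
  then have "root_of_unity p ^ ((p - l) * k) * root_of_unity p ^ (l * k) = 1"
    by (simp add: root_of_unity_power_self assms(1))
  \<comment> \<open>Multiplying by the power of the conjugate, which is the inverse, cancels the
    second factor.\<close>
  then have "root_of_unity p ^ ((p - l) * k) * (root_of_unity p * cnj (root_of_unity p)) ^ (l * k)
      = cnj (root_of_unity p) ^ (l * k)"
    by (simp only: power_mult_distrib mult.assoc[symmetric] mult_1_left)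
  then show ?thesis
    by (simp add: root_of_unity_mult_cnj)
qed

lemma root_of_unity_power_inj:
  assumes "a < p" "b < p" "root_of_unity p ^ a = root_of_unity p ^ b"
  shows "a = b"
  using bij_betw_imp_inj_on[OF bij_betw_roots_unity, of p] assms
  by (auto simp: root_of_unity_power inj_on_def)

text \<open>The sum is geometric with a ratio \<open>z\<close> satisfying \<open>z ^ p = 1\<close>,
  so it vanishes unless \<open>z = 1\<close>, which forces \<open>a = b\<close>.\<close>

lemma root_of_unity_orthogonality:
  assumes "a < p" "b < p"
  shows "(\<Sum>k<p. cnj (root_of_unity p) ^ (k * a) * root_of_unity p ^ (k * b)) =
    (if a = b then of_nat p else 0)"
proof -
  define \<omega> where "\<omega> = root_of_unity p"
  define z where "z = cnj \<omega> ^ a * \<omega> ^ b"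
  have unit: "\<omega> ^ j * cnj \<omega> ^ j = 1" for j
    by (simp add: \<omega>_def root_of_unity_mult_cnj flip: power_mult_distrib)
  have "\<omega> ^ p = 1"
    using assms by (simp add: \<omega>_def root_of_unity_power_self)
  then have "z ^ p = 1"
    by (metis complex_cnj_one complex_cnj_power mult_1 power_commutes power_mult
        power_mult_distrib power_one mult.commute z_def)
  have "cnj \<omega> ^ (k * a) * \<omega> ^ (k * b) = z ^ k" for k
    by (simp add: z_def power_mult_distrib mult.commute flip: power_mult)
  then have sum: "(\<Sum>k<p. cnj \<omega> ^ (k * a) * \<omega> ^ (k * b)) = (\<Sum>k<p. z ^ k)"
    by simp
  show ?thesis
  proof (cases "a = b")
    case True
    then have "z = 1"
      using unit[of a] by (simp add: z_def mult.commute)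
    then show ?thesis
      using True sum by (simp add: \<omega>_def)
  next
    case False
    have "z \<noteq> 1"
    proof
      assume "z = 1"
      then have "\<omega> ^ a = (\<omega> ^ a * cnj \<omega> ^ a) * \<omega> ^ b"
        by (simp add: z_def mult.assoc)
      then have "\<omega> ^ a = \<omega> ^ b"
        by (simp add: unit)
      with False show False
        using root_of_unity_power_inj[OF assms] by (simp add: \<omega>_def)
    qed
    then have "(\<Sum>k<p. z ^ k) = 0"
      by (simp add: geometric_sum \<open>z ^ p = 1\<close>)
    then show ?thesis
      using False sum by (simp add: \<omega>_def)
  qed
qed

section \<open>The transform: reflection, norm bound, reality and Parseval's identity\<close>

text \<open>Both indices start at 0, so that frequencies reflect as \<open>l\<close> to
  \<open>p - l\<close>. Values stay complex, which leaves the \<open>Re\<close> of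
  \<open>kilmer_martin\<close> to be justified by symmetry.\<close>

definition inverse_dft :: "nat \<Rightarrow> (nat \<Rightarrow> real) \<Rightarrow> nat \<Rightarrow> complex" where
  "inverse_dft p d k =
     1 / of_nat p * (\<Sum>l<p. cnj (root_of_unity p) ^ (k * l) * of_real (d l))"

lemma inverse_dft_0: "inverse_dft p d 0 = of_real ((\<Sum>l<p. d l) / real p)"
  by (simp add: inverse_dft_def)

lemma cnj_inverse_dft:
  "cnj (inverse_dft p d k) = 1 / of_nat p * (\<Sum>l<p. root_of_unity p ^ (k * l) * of_real (d l))"
  by (simp add: inverse_dft_def)

lemma inverse_dft_reflect:
  assumes "p > 0" "k \<le> p"
  shows "inverse_dft p d (p - k) = cnj (inverse_dft p d k)"
proof -
  have "cnj (root_of_unity p) ^ ((p - k) * l) = root_of_unity p ^ (k * l)" for l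
    using arg_cong[OF root_of_unity_power_diff[OF assms, of l], of cnj] by simp
  then show ?thesis
    by (simp only: cnj_inverse_dft) (simp add: inverse_dft_def)
qed

text \<open>Triangle inequality with weights of modulus 1; the bound is the value at frequency
  0.\<close>

lemma norm_inverse_dft_le:
  assumes "\<And>l. l < p \<Longrightarrow> 0 \<le> d l"
  shows "norm (inverse_dft p d k) \<le> (\<Sum>l<p. d l) / real p"
proof -
  have "norm (\<Sum>l<p. cnj (root_of_unity p) ^ (k * l) * of_real (d l)) \<le> (\<Sum>l<p. d l)"
    using assms by (intro sum_norm_le) (simp add: norm_mult norm_power norm_root_of_unity)
  then show ?thesis
    by (simp add: inverse_dft_def norm_mult norm_divide divide_right_mono)
qed

lemma inverse_dft_real:
  assumes sym: "\<And>l. 1 \<le> l \<Longrightarrow> l < p \<Longrightarrow> d (p - l) = d l"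
  shows "inverse_dft p d k \<in> \<real>"
proof (cases "p = 0")
  case False
  define f where "f l = cnj (root_of_unity p) ^ (k * l) * complex_of_real (d l)" for l
  have refl: "f (p - l) = cnj (f l)" if "1 \<le> l" "l < p" for l
  proof -
    have "cnj (root_of_unity p) ^ (k * (p - l)) = root_of_unity p ^ (k * l)"
      using arg_cong[OF root_of_unity_power_diff[of p l k], of cnj] that
      by (simp add: mult.commute)
    then show ?thesis
      using that by (simp add: f_def sym)
  qed
  \<comment> \<open>The term at 0 is real and is split off because \<open>p - 0\<close> lies outside
    the range; on the rest, \<open>l\<close> to \<open>p - l\<close> is an involution that
    conjugates the terms.\<close>
  have "(\<Sum>l<p. f l) = f 0 + (\<Sum>l\<in>{1..<p}. f l)"
    using False by (simp add: lessThan_atLeast0 sum.atLeast_Suc_lessThan)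
  moreover have "cnj (f 0) = f 0"
    by (simp add: f_def)
  moreover have "cnj (\<Sum>l\<in>{1..<p}. f l) = (\<Sum>l\<in>{1..<p}. f l)"
    unfolding cnj_sum
    by (rule sum.reindex_bij_witness[where i = "\<lambda>l. p - l" and j = "\<lambda>l. p - l"])
      (auto simp: refl)
  ultimately have "cnj (\<Sum>l<p. f l) = (\<Sum>l<p. f l)"
    by (simp only: complex_cnj_add)
  then have "cnj (inverse_dft p d k) = inverse_dft p d k"
    by (simp add: inverse_dft_def flip: f_def)
  then show ?thesis
    by (simp add: Reals_cnj_iff)
qed (simp add: inverse_dft_def)

text \<open>Expand the squared modulus as a double sum and move the sum over \<open>k\<close>
  innermost: orthogonality leaves the diagonal, with factor \<open>p\<close> against the prefactor
  \<open>1 / p\<^sup>2\<close>.\<close>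

lemma inverse_dft_parseval:
  assumes "p > 0"
  shows "(\<Sum>k<p. (norm (inverse_dft p d k))\<^sup>2) = (\<Sum>l<p. (d l)\<^sup>2) / real p"
proof -
  have "complex_of_real (\<Sum>k<p. (norm (inverse_dft p d k))\<^sup>2) =
      (\<Sum>k<p. inverse_dft p d k * cnj (inverse_dft p d k))"
    by (simp only: of_real_sum complex_norm_square)
  also have "\<dots> = (\<Sum>k<p. 1 / (of_nat p)\<^sup>2 * (\<Sum>a<p. \<Sum>b<p.
      (cnj (root_of_unity p) ^ (k * a) * root_of_unity p ^ (k * b)) * of_real (d a * d b)))"
  proof (rule sum.cong[OF refl])
    fix k
    let ?X = "\<Sum>a<p. cnj (root_of_unity p) ^ (k * a) * complex_of_real (d a)"
    let ?Y = "\<Sum>b<p. root_of_unity p ^ (k * b) * complex_of_real (d b)"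
    have "inverse_dft p d k * cnj (inverse_dft p d k) = 1 / (of_nat p)\<^sup>2 * (?X * ?Y)"
      unfolding cnj_inverse_dft unfolding inverse_dft_def by (simp add: power2_eq_square)
    also have "?X * ?Y = (\<Sum>a<p. \<Sum>b<p.
        (cnj (root_of_unity p) ^ (k * a) * root_of_unity p ^ (k * b)) * of_real (d a * d b))"
      unfolding sum_product by (intro sum.cong refl) (simp add: mult_ac)
    finally show "inverse_dft p d k * cnj (inverse_dft p d k) =
        1 / (of_nat p)\<^sup>2 * (\<Sum>a<p. \<Sum>b<p.
          (cnj (root_of_unity p) ^ (k * a) * root_of_unity p ^ (k * b)) * of_real (d a * d b))" .
  qed
  also have "\<dots> = 1 / (of_nat p)\<^sup>2 * (\<Sum>k<p. \<Sum>a<p. \<Sum>b<p.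
      (cnj (root_of_unity p) ^ (k * a) * root_of_unity p ^ (k * b)) * of_real (d a * d b))"
    by (simp only: sum_distrib_left)
  also have "(\<Sum>k<p. \<Sum>a<p. \<Sum>b<p.
      (cnj (root_of_unity p) ^ (k * a) * root_of_unity p ^ (k * b)) * of_real (d a * d b)) =
    (\<Sum>a<p. \<Sum>b<p. (\<Sum>k<p.
      cnj (root_of_unity p) ^ (k * a) * root_of_unity p ^ (k * b)) * of_real (d a * d b))"
    by (subst sum.swap, rule sum.cong[OF refl], subst sum.swap) (simp only: sum_distrib_right)
  also have "\<dots> = (\<Sum>a<p. \<Sum>b<p. if a = b then of_nat p * of_real (d a * d b) else 0)"
    by (intro sum.cong refl) (simp add: root_of_unity_orthogonality)
  also have "\<dots> = of_nat p * of_real (\<Sum>a<p. (d a)\<^sup>2)"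
    by (simp add: sum_distrib_left power2_eq_square)
  finally have "complex_of_real (\<Sum>k<p. (norm (inverse_dft p d k))\<^sup>2) =
      of_real ((\<Sum>l<p. (d l)\<^sup>2) / real p)"
    using assms by (simp add: power2_eq_square)
  then show ?thesis
    by (simp only: of_real_eq_iff)
qed

section \<open>The Kilmer-Martin mapping\<close>

lemma Delta_carrier: "Delta m n p A k \<in> carrier_mat m n"
  by (simp add: Delta_def)

text \<open>The entries of \<open>A\<close> are real, so conjugation acts on the roots of unity
  only. Frequency \<open>l\<close> sits at slice \<open>Suc l\<close>.\<close>

lemma Delta_reflect:
  assumes "1 \<le> l" "l < p"
  shows "Delta m n p A (Suc (p - l)) = map_mat cnj (Delta m n p A (Suc l))"
proof -
  have "root_of_unity p ^ (j * (p - l)) = cnj (root_of_unity p) ^ (j * l)" for j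
    using root_of_unity_power_diff[of p l j] assms by (simp add: mult.commute)
  then show ?thesis
    by (intro eq_matI) (auto simp: Delta_def)
qed

lemma Dval_reflect:
  "1 \<le> l \<Longrightarrow> l < p \<Longrightarrow> Dval m n p A i (Suc (p - l)) = Dval m n p A i (Suc l)"
  by (simp add: Dval_def Delta_reflect singular_values_conjugate)

lemma Dval_nonneg:
  assumes "i \<in> {1..min m n}"
  shows "0 \<le> Dval m n p A i k"
  unfolding Dval_def
  by (rule singular_values_nonneg[OF Delta_carrier], rule nth_mem)
    (use assms in \<open>auto simp: length_singular_values[OF Delta_carrier]\<close>)

lemma Dval_antimono:
  assumes "i \<in> {1..<min m n}"
  shows "Dval m n p A (i + 1) k \<le> Dval m n p A i k"
  unfolding Dval_def
  by (rule sorted_wrt_nth_less[OF sorted_singular_values])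
    (use assms in \<open>auto simp: length_singular_values[OF Delta_carrier]\<close>)

section \<open>Tubes as inverse transforms\<close>

lemma kilmer_martin_inverse_dft:
  assumes "i \<in> {1..min m n}" "k \<in> {1..p}"
  shows "kilmer_martin m n p A i i k =
    Re (inverse_dft p (\<lambda>l. Dval m n p A i (Suc l)) (k - 1))"
  using assms by (simp add: kilmer_martin_def inverse_dft_def sum.atLeast1_atMost_eq)

lemma kilmer_martin_first:
  assumes "i \<in> {1..min m n}" "p > 0"
  shows "kilmer_martin m n p A i i 1 = (\<Sum>l<p. Dval m n p A i (Suc l)) / real p"
  using assms by (subst kilmer_martin_inverse_dft) (auto simp: inverse_dft_0 simp del: of_real_divide)

text \<open>The reflection symmetry of \<open>Dval\<close> makes the transform real, so
  \<open>Re\<close> loses nothing and Parseval's identity applies.\<close>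

lemma kilmer_martin_tube_norm:
  assumes "i \<in> {1..min m n}" "p > 0"
  shows "(\<Sum>k = 1..p. (kilmer_martin m n p A i i k)\<^sup>2) =
    (\<Sum>l<p. (Dval m n p A i (Suc l))\<^sup>2) / real p"
proof -
  define d where "d l = Dval m n p A i (Suc l)" for l
  have real: "inverse_dft p d k \<in> \<real>" for k
    by (rule inverse_dft_real) (simp add: d_def Dval_reflect)
  have "(\<Sum>k = 1..p. (kilmer_martin m n p A i i k)\<^sup>2) =
      (\<Sum>k = 1..p. (Re (inverse_dft p d (k - 1)))\<^sup>2)"
    using assms(1) by (intro sum.cong refl) (simp add: kilmer_martin_inverse_dft d_def[abs_def])
  also have "\<dots> = (\<Sum>k<p. (Re (inverse_dft p d k))\<^sup>2)"
    by (simp add: sum.atLeast1_atMost_eq)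
  also have "\<dots> = (\<Sum>k<p. (norm (inverse_dft p d k))\<^sup>2)"
    using real by (simp add: in_Reals_norm)
  finally show ?thesis
    using inverse_dft_parseval[OF assms(2), of d] by (simp add: d_def)
qed

theorem theorem5p1:
  fixes m n p q :: nat and S :: tensor
  assumes "m \<ge> 1" and "n \<ge> 1" and "p \<ge> 2"
    and "S \<in> s_diagonal_tensors m n p"
    and "q = min m n"
  shows
    "(\<forall>i\<in>{1..<q}. (\<Sum>k = 1..p. (S i i k)\<^sup>2) \<ge> (\<Sum>k = 1..p. (S (i + 1) (i + 1) k)\<^sup>2)) \<and>
     ((\<forall>i\<in>{1..<q}. S i i 1 \<ge> S (i + 1) (i + 1) 1) \<and> S q q 1 \<ge> 0) \<and>
     (\<forall>i\<in>{1..q}. \<forall>k\<in>{2..1 + (p - 1) div 2}. S i i k = S i i (p - k + 2)) \<and>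
     (\<forall>i\<in>{1..q}. \<forall>k\<in>{1..p}. S i i 1 \<ge> \<bar>S i i k\<bar>)"
proof -
  obtain A where S: "S = kilmer_martin m n p A"
    using assms(4) by (auto simp: s_diagonal_tensors_def)
  have p: "p > 0"
    using assms(3) by simp
  note nonneg = Dval_nonneg[of _ m n p A] and antimono = Dval_antimono[of _ m n p A]
  have "(\<Sum>k = 1..p. (S (i + 1) (i + 1) k)\<^sup>2) \<le> (\<Sum>k = 1..p. (S i i k)\<^sup>2)"
    if i: "i \<in> {1..<q}" for i
  proof -
    have i': "i \<in> {1..min m n}" "i + 1 \<in> {1..min m n}" "i \<in> {1..<min m n}"
      using i assms(5) by auto
    show ?thesis
      unfolding S kilmer_martin_tube_norm[OF i'(1) p] kilmer_martin_tube_norm[OF i'(2) p]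
      \<comment> \<open>Squaring preserves the order of the singular values because they are
        nonnegative.\<close>
      by (intro divide_right_mono sum_mono power_mono antimono nonneg i') simp
  qed
  moreover have "S (i + 1) (i + 1) 1 \<le> S i i 1" if i: "i \<in> {1..<q}" for i
  proof -
    have i': "i \<in> {1..min m n}" "i + 1 \<in> {1..min m n}" "i \<in> {1..<min m n}"
      using i assms(5) by auto
    show ?thesis
      unfolding S kilmer_martin_first[OF i'(1) p] kilmer_martin_first[OF i'(2) p]
      by (intro divide_right_mono sum_mono antimono i') simp
  qed
  moreover have "S q q 1 \<ge> 0"
  proof -
    have q: "q \<in> {1..min m n}"
      using assms by simp
    show ?thesis
      unfolding S kilmer_martin_first[OF q p] by (simp add: sum_nonneg nonneg[OF q])
  qed
  moreover have "S i i k = S i i (p - k + 2)"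
    if "i \<in> {1..q}" and k: "k \<in> {2..1 + (p - 1) div 2}" for i k
  proof -
    have i: "i \<in> {1..min m n}"
      using that assms(5) by simp
    \<comment> \<open>Counted from 0, the two frequencies are \<open>k - 1\<close> and
      \<open>p - (k - 1)\<close>; their transforms are conjugate and share the real part.\<close>
    have "k \<in> {1..p}" "p - k + 2 \<in> {1..p}" "p - k + 2 - 1 = p - (k - 1)" "k - 1 \<le> p"
      using k p by auto
    then show ?thesis
      by (simp only: S kilmer_martin_inverse_dft[OF i] inverse_dft_reflect[OF p] complex_cnj)
        simp
  qed
  moreover have "\<bar>S i i k\<bar> \<le> S i i 1" if "i \<in> {1..q}" and k: "k \<in> {1..p}" for i k
  proof -
    have i: "i \<in> {1..min m n}"
      using that assms(5) by simp
    show ?thesis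
      unfolding S kilmer_martin_first[OF i p] kilmer_martin_inverse_dft[OF i k]
      \<comment> \<open>The real part is bounded by the modulus, and the modulus by the mean of the
        singular values, which is the first entry.\<close>
      by (rule order_trans[OF abs_Re_le_cmod norm_inverse_dft_le]) (rule nonneg[OF i])
  qed
  ultimately show ?thesis
    by blast
qed

end
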